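(* Let $f:\mathbb{R}\to\mathbb{R}$ be continuous with $\lim_{|x|\to\infty} f(x)/x=0$, let $k=(k(n))_{n\ge 0}$ be a real sequence with $\sum_{j=0}^\infty |k(j)|<+\infty$, let $(H(n))_{n\ge 1}$ be a real sequence, let $\xi\in\mathbb{R}$, and let $(x(n))_{n\ge 0}$ be the real sequence defined by $x(0)=\xi$ and $$x(n+1)=H(n+1)+\sum_{j=0}^n k(n-j)f(x(j)),\quad n\ge 0.$$ Suppose $H^*(n)\to\infty$ as $n\to\infty$ and that there is $\lambda\in[0,\infty]$ such that $$\lambda=\lim_{n\to\infty}\frac{H^*_-(n)}{H^*_+(n)}.$$ (i) If $\lambda\in[0,1)$, then $\lim_{n\to\infty}x^*_+(n)=+\infty$ and $$\lim_{n\to\infty}\frac{x^*_+(n)}{H^*_+(n)}=\lim_{n\to\infty}\frac{x^*(n)}{H^*_+(n)}=1.$$ (ii) If $\lambda\in(1,\infty]$, then $\lim_{n\to\infty}x^*_-(n)=+\infty$ and $$\lim_{n\to\infty}\frac{x^*_-(n)}{H^*_-(n)}=\lim_{n\to\infty}\frac{x^*(n)}{H^*_-(n)}=1.$$ (iii) If $\lambda=1$, then $\lim_{n\to\infty}x^*_+(n)=+\infty$, $\lim_{n\to\infty}x^*_-(n)=+\infty$, and $$\lim_{n\to\infty}\frac{x^*_+(n)}{H^*_+(n)}=\lim_{n\to\infty}\frac{x^*_-(n)}{H^*_-(n)}=1.$$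
   Context: Notation: $H^*(n)=\max_{1\le j\le n}|H(j)|$, $H^*_+(n)=\max_{1\le j\le n}H(j)$, $H^*_-(n)=-\min_{1\le j\le n}H(j)=\max_{1\le j\le n}(-H(j))$; $x^*(n)=\max_{0\le j\le n}|x(j)|$, $x^*_+(n)=\max_{0\le j\le n}x(j)$, $x^*_-(n)=-\min_{0\le j\le n}x(j)=\max_{0\le j\le n}(-x(j))$. *)

theory Defs
  imports "HOL-Analysis.Analysis"
begin

text \<open>
  Running extrema of \<open>a\<close> over the indices \<open>m, \<dots>, n\<close>. They are unspecified for
  \<open>n < m\<close>; with \<open>m = 1\<close> this affects only the term \<open>n = 0\<close>, which is irrelevant in limits
  as \<open>n\<close> tends to infinity.
\<close>

definition max_abs :: "nat \<Rightarrow> (nat \<Rightarrow> real) \<Rightarrow> nat \<Rightarrow> real" where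
  "max_abs m a n = Max ((\<lambda>j. \<bar>a j\<bar>) ` {m..n})"

definition max_pos :: "nat \<Rightarrow> (nat \<Rightarrow> real) \<Rightarrow> nat \<Rightarrow> real" where
  "max_pos m a n = Max (a ` {m..n})"

definition max_neg :: "nat \<Rightarrow> (nat \<Rightarrow> real) \<Rightarrow> nat \<Rightarrow> real" where
  "max_neg m a n = - Min (a ` {m..n})"

text \<open>
  The ratio of the running extrema of a sequence indexed from 1, as an extended real.
  For a nonzero denominator it is the real quotient. When the denominator is \<open>0\<close> and the numerator
  positive its value is \<open>\<infinity>\<close>, whereas real division would give \<open>0\<close>.
\<close>

definition neg_pos_ratio :: "(nat \<Rightarrow> real) \<Rightarrow> nat \<Rightarrow> ereal" where
  "neg_pos_ratio H n = ereal (max_neg 1 H n) / ereal (max_pos 1 H n)"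

end

theory Submission
  imports Defs
begin

text \<open>
  Since \<open>f\<close> is sublinear, \<open>\<bar>f y\<bar> \<le> L + \<epsilon> * \<bar>y\<bar>\<close> with \<open>\<epsilon>\<close> as small as desired, and since
  \<open>k\<close> is summable, the convolution term at times up to \<open>n\<close> is at most a constant plus a small
  multiple of the running maximum of \<open>\<bar>x\<bar>\<close>. Absorbing the latter on the left-hand side bounds this
  running maximum by a constant plus a multiple of \<open>max_abs 1 H n\<close>. As \<open>max_abs 1 H\<close> diverges, the
  constants are negligible, so that up to time \<open>n\<close> the sequences \<open>x\<close> and \<open>H\<close> differ uniformly by
  \<open>o(max_abs 1 H n)\<close> (\<open>volterra_close_to_forcing\<close>).

  Running maxima are insensitive to such a perturbation as soon as they are at least a fixed
  fraction of its scale (\<open>max_pos_close_sequences\<close>). Applying this to \<open>x, H\<close>, to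
  \<open>-x, -H\<close> and to \<open>\<bar>x\<bar>, \<bar>H\<bar>\<close> gives the statements about \<open>max_pos\<close>, \<open>max_neg\<close> and \<open>max_abs\<close>.
  The limit \<open>l\<close> of the ratios decides which one-sided maxima of \<open>H\<close> are comparable with \<open>max_abs 1 H\<close>: the
  larger one, equal to \<open>max_abs 1 H\<close>, when \<open>l \<noteq> 1\<close>, and both when \<open>l = 1\<close>.
\<close>

section \<open>Running extrema\<close>

lemma max_abs_eq_max_pos: "max_abs m a = max_pos m (\<lambda>j. \<bar>a j\<bar>)"
  by (simp add: fun_eq_iff max_abs_def max_pos_def)

lemma max_neg_eq_max_pos:
  assumes "m \<le> n"
  shows "max_neg m a n = max_pos m (\<lambda>j. - a j) n"
proof -
  have "Max ((\<lambda>j. - a j) ` {m..n}) = Max (uminus ` (a ` {m..n}))"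
    by (simp add: image_image)
  also have "\<dots> = - Min (a ` {m..n})"
    using assms by (intro minus_Min_eq_Max[symmetric]) auto
  finally show ?thesis
    by (simp add: max_neg_def max_pos_def)
qed

lemma le_max_pos: "m \<le> j \<Longrightarrow> j \<le> n \<Longrightarrow> a j \<le> max_pos m a n"
  unfolding max_pos_def by (intro Max_ge) auto

lemma max_pos_le_iff:
  "m \<le> n \<Longrightarrow> max_pos m a n \<le> c \<longleftrightarrow> (\<forall>j\<in>{m..n}. a j \<le> c)"
  unfolding max_pos_def by (subst Max_le_iff) auto

lemma max_abs_eq_max:
  assumes "m \<le> n"
  shows "max_abs m a n = max (max_pos m a n) (max_neg m a n)"
proof (rule antisym)
  show "max_abs m a n \<le> max (max_pos m a n) (max_neg m a n)"
    unfolding max_abs_eq_max_pos max_neg_eq_max_pos[OF assms] max_pos_le_iff[OF assms]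
  proof
    fix j assume "j \<in> {m..n}"
    then have "a j \<le> max_pos m a n" "- a j \<le> max_pos m (\<lambda>j. - a j) n"
      using le_max_pos[of m j n a] le_max_pos[of m j n "\<lambda>j. - a j"] by auto
    then show "\<bar>a j\<bar> \<le> max (max_pos m a n) (max_pos m (\<lambda>j. - a j) n)" by linarith
  qed
  have "a j \<le> max_abs m a n" "- a j \<le> max_abs m a n" if "j \<in> {m..n}" for j
    using that le_max_pos[of m j n "\<lambda>j. \<bar>a j\<bar>"] by (auto simp: max_abs_eq_max_pos)
  then show "max (max_pos m a n) (max_neg m a n) \<le> max_abs m a n"
    by (simp add: max_neg_eq_max_pos[OF assms] max_pos_le_iff[OF assms])
qed

text \<open>
  The scale \<open>s\<close> is kept separate from \<open>b\<close> because for \<open>max_pos\<close> of \<open>b\<close> the perturbation is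
  controlled only by the running maximum of \<open>\<bar>b\<bar>\<close>. The comparison with \<open>C\<close> turns an error
  \<open>o(s n)\<close> into an error relative to \<open>max_pos 1 b n\<close>. The value \<open>a 0\<close>, which has no counterpart in
  \<open>b\<close>, is eventually dominated because \<open>max_pos 1 b\<close> diverges.
\<close>

lemma max_pos_close_sequences:
  fixes a b s :: "nat \<Rightarrow> real"
  assumes close: "\<And>\<delta>. \<delta> > 0 \<Longrightarrow> \<forall>\<^sub>F n in sequentially. \<forall>j\<in>{1..n}. \<bar>a j - b j\<bar> \<le> \<delta> * s n"
    and s: "filterlim s at_top sequentially"
    and C: "C > 0" "\<forall>\<^sub>F n in sequentially. s n \<le> C * max_pos 1 b n"
  shows "(\<lambda>n. max_pos 0 a n / max_pos 1 b n) \<longlonglongrightarrow> 1"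
    and "filterlim (max_pos 0 a) at_top sequentially"
proof -
  have "filterlim (\<lambda>n. C * max_pos 1 b n) at_top sequentially"
    by (rule filterlim_at_top_mono[OF s C(2)])
  then have "filterlim (\<lambda>n. (1 / C) * (C * max_pos 1 b n)) at_top sequentially"
    by (rule filterlim_tendsto_pos_mult_at_top[OF tendsto_const, rotated]) (use C in simp)
  then have b: "filterlim (max_pos 1 b) at_top sequentially"
    using C by simp
  show lim: "(\<lambda>n. max_pos 0 a n / max_pos 1 b n) \<longlonglongrightarrow> 1"
  proof (rule tendstoI)
    fix e :: real assume e: "e > 0"
    define d where "d = e / (2 * C)"
    have d: "d > 0" using e C by (simp add: d_def)
    have b0: "\<forall>\<^sub>F n in sequentially. max_pos 1 b n > max 0 (a 0)"
      using b unfolding filterlim_at_top_dense by blast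
    show "\<forall>\<^sub>F n in sequentially. dist (max_pos 0 a n / max_pos 1 b n) 1 < e"
      using close[OF d] b0 C(2) eventually_ge_at_top[of 1]
    proof eventually_elim
      case (elim n)
      define p q where "p = max_pos 0 a n" and "q = max_pos 1 b n"
      have q: "q > 0" "a 0 \<le> q" using elim by (auto simp: q_def)
      have "d * s n \<le> d * (C * q)"
        using elim d unfolding q_def by (intro mult_left_mono) auto
      also have "\<dots> = e / 2 * q" using C by (simp add: d_def)
      finally have ds: "d * s n \<le> e / 2 * q" .
      have "a j \<le> q + e / 2 * q" if "j \<le> n" for j
      proof (cases "j = 0")
        case True
        have "0 \<le> e / 2 * q" using e q by simp
        with True q show ?thesis by simp
      next
        case False
        then have "b j \<le> q" "\<bar>a j - b j\<bar> \<le> d * s n"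
          using that elim le_max_pos[of 1 j n b] by (auto simp: q_def)
        then show ?thesis using ds by linarith
      qed
      then have up: "p \<le> q + e / 2 * q" by (simp add: p_def max_pos_le_iff)
      have "b j \<le> p + e / 2 * q" if "j \<in> {1..n}" for j
      proof -
        have "a j \<le> p" "\<bar>a j - b j\<bar> \<le> d * s n"
          using that elim le_max_pos[of 0 j n a] by (auto simp: p_def)
        then show ?thesis using ds by linarith
      qed
      then have lo: "q \<le> p + e / 2 * q"
        using elim by (simp add: q_def max_pos_le_iff)
      have "\<bar>p - q\<bar> \<le> e / 2 * q" using up lo by linarith
      also have "\<dots> < e * q" using e q by simp
      finally have "\<bar>p - q\<bar> / q < e" using q by (simp add: divide_less_eq)
      moreover have "p / q - 1 = (p - q) / q" using q by (simp add: field_simps)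
      ultimately show ?case using q by (simp add: dist_real_def p_def q_def)
    qed
  qed
  have "filterlim (\<lambda>n. max_pos 0 a n / max_pos 1 b n * max_pos 1 b n) at_top sequentially"
    by (rule filterlim_tendsto_pos_mult_at_top[OF lim _ b]) simp
  moreover have "\<forall>\<^sub>F n in sequentially. max_pos 1 b n > 0"
    using b by (simp add: filterlim_at_top_dense)
  then have "\<forall>\<^sub>F n in sequentially.
      max_pos 0 a n / max_pos 1 b n * max_pos 1 b n = max_pos 0 a n"
    by eventually_elim simp
  ultimately show "filterlim (max_pos 0 a) at_top sequentially"
    using filterlim_cong[OF refl refl] by fast
qed

section \<open>The solution follows the forcing sequence\<close>

text \<open>
  Continuity enters only through boundedness on the compact interval outside of which
  \<open>\<bar>f y\<bar> \<le> \<epsilon> * \<bar>y\<bar>\<close>.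
\<close>

lemma sublinear_bound:
  fixes f :: "real \<Rightarrow> real"
  assumes "continuous_on UNIV f" "((\<lambda>y. f y / y) \<longlongrightarrow> 0) at_infinity" "\<epsilon> > 0"
  obtains L where "L \<ge> 0" "\<And>y. \<bar>f y\<bar> \<le> L + \<epsilon> * \<bar>y\<bar>"
proof -
  have "\<forall>\<^sub>F y in at_infinity. dist (f y / y) 0 < \<epsilon>"
    using assms by (intro tendstoD)
  then obtain B where B: "\<And>y. B \<le> \<bar>y\<bar> \<Longrightarrow> \<bar>f y / y\<bar> < \<epsilon>"
    by (auto simp: eventually_at_infinity dist_real_def)
  have "compact (f ` {- \<bar>B\<bar>..\<bar>B\<bar>})"
    by (intro compact_continuous_image continuous_on_subset[OF assms(1)]) auto
  then obtain L where "\<forall>z\<in>f ` {- \<bar>B\<bar>..\<bar>B\<bar>}. \<bar>z\<bar> \<le> L"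
    using compact_imp_bounded bounded_real by metis
  then have L: "\<bar>f y\<bar> \<le> L" if "\<bar>y\<bar> \<le> \<bar>B\<bar>" for y
    using that by (simp add: abs_le_iff)
  show thesis
  proof (rule that)
    show "L \<ge> 0" using L[of 0] by simp
    show "\<bar>f y\<bar> \<le> L + \<epsilon> * \<bar>y\<bar>" for y
    proof (cases "\<bar>y\<bar> \<le> \<bar>B\<bar>")
      case True
      then show ?thesis using L[of y] \<open>\<epsilon> > 0\<close> by (simp add: add_increasing2)
    next
      case False
      then have "\<bar>f y\<bar> / \<bar>y\<bar> < \<epsilon>" "\<bar>y\<bar> > 0" using B[of y] by (auto simp: abs_divide)
      then have "\<bar>f y\<bar> \<le> \<epsilon> * \<bar>y\<bar>" by (simp add: divide_less_eq split: if_splits)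
      then show ?thesis using \<open>L \<ge> 0\<close> by simp
    qed
  qed
qed

text \<open>Young's inequality for the exponents \<open>1\<close> and \<open>\<infinity>\<close>.\<close>

lemma abs_convolution_le:
  fixes k g :: "nat \<Rightarrow> real"
  assumes "summable (\<lambda>j. \<bar>k j\<bar>)" "\<And>j. j \<le> n \<Longrightarrow> \<bar>g j\<bar> \<le> G"
  shows "\<bar>\<Sum>j=0..n. k (n - j) * g j\<bar> \<le> (\<Sum>j. \<bar>k j\<bar>) * G"
proof -
  have G: "G \<ge> 0" using assms(2)[of 0] by simp
  have "\<bar>\<Sum>j=0..n. k (n - j) * g j\<bar> \<le> (\<Sum>j=0..n. \<bar>k (n - j)\<bar> * G)"
    by (rule order.trans[OF sum_abs])
      (auto intro!: sum_mono mult_left_mono assms simp: abs_mult)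
  also have "\<dots> = (\<Sum>j=0..n. \<bar>k j\<bar>) * G"
    using sum.atLeastAtMost_rev[of "\<lambda>j. \<bar>k j\<bar>" 0 n] by (simp add: sum_distrib_right)
  also have "\<dots> \<le> (\<Sum>j. \<bar>k j\<bar>) * G"
    by (intro mult_right_mono sum_le_suminf G) (use assms in auto)
  finally show ?thesis .
qed

text \<open>
  Write \<open>K\<close> for the sum of \<open>\<bar>k\<bar>\<close> and \<open>X\<close> for \<open>max_abs 0 x n\<close>. For \<open>1 \<le> j \<le> n\<close> the convolution
  term at \<open>j\<close> is at most \<open>K * (L + \<epsilon> * X)\<close>, hence \<open>X \<le> \<bar>x 0\<bar> + max_abs 1 H n + K * L + K * \<epsilon> * X\<close>.
  If \<open>K * \<epsilon> \<le> 1 / 2\<close>, the last term can be absorbed, and inserting the resulting bound on \<open>X\<close> into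
  the bound on the convolution gives the claim.
\<close>

lemma volterra_close_to_forcing:
  fixes f :: "real \<Rightarrow> real" and k H x :: "nat \<Rightarrow> real"
  assumes f: "continuous_on UNIV f" "((\<lambda>y. f y / y) \<longlongrightarrow> 0) at_infinity"
    and k: "summable (\<lambda>j. \<bar>k j\<bar>)"
    and x: "\<And>n. x (n + 1) = H (n + 1) + (\<Sum>j=0..n. k (n - j) * f (x j))"
    and H: "filterlim (max_abs 1 H) at_top sequentially"
    and d: "\<delta> > 0"
  shows "\<forall>\<^sub>F n in sequentially. \<forall>j\<in>{1..n}. \<bar>x j - H j\<bar> \<le> \<delta> * max_abs 1 H n"
proof -
  define K where "K = (\<Sum>j. \<bar>k j\<bar>)"
  have K: "K \<ge> 0" unfolding K_def by (rule suminf_nonneg[OF k]) simp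
  \<comment> \<open>Both \<open>\<eta> \<le> 1 / 2\<close>, for the absorption, and \<open>2 * \<eta> \<le> \<delta> / 2\<close>, for the final estimate, are used;
      the denominator \<open>K + 1\<close> covers \<open>K = 0\<close>.\<close>
  define \<eta> where "\<eta> = min (1 / 2) (\<delta> / 4)"
  define \<epsilon> where "\<epsilon> = \<eta> / (K + 1)"
  have \<eta>: "\<eta> > 0" "\<eta> \<le> 1 / 2" "\<eta> \<le> \<delta> / 4" using d by (auto simp: \<eta>_def)
  have \<epsilon>: "\<epsilon> > 0" "K * \<epsilon> \<le> \<eta>" using K \<eta> by (auto simp: \<epsilon>_def field_simps)
  obtain L where L: "L \<ge> 0" "\<And>y. \<bar>f y\<bar> \<le> L + \<epsilon> * \<bar>y\<bar>"
    using sublinear_bound[OF f \<epsilon>(1)] by blast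
  define c where "c = \<bar>x 0\<bar> + K * L"
  have c: "c \<ge> 0" "K * L \<le> c" using K L by (auto simp: c_def)
  have "\<forall>\<^sub>F n in sequentially. max_abs 1 H n \<ge> c * (1 + 2 * \<eta>) / (\<delta> / 2)"
    using H by (simp add: filterlim_at_top)
  then show ?thesis
    using eventually_ge_at_top[of 1]
  proof eventually_elim
    case (elim n)
    define X M where "X = max_abs 0 x n" and "M = max_abs 1 H n"
    have xX: "\<bar>x j\<bar> \<le> X" if "j \<le> n" for j
      using that le_max_pos[of 0 j n "\<lambda>j. \<bar>x j\<bar>"] by (simp add: X_def max_abs_eq_max_pos)
    have HM: "\<bar>H j\<bar> \<le> M" if "j \<in> {1..n}" for j
      using that le_max_pos[of 1 j n "\<lambda>j. \<bar>H j\<bar>"] by (simp add: M_def max_abs_eq_max_pos)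
    have X0: "X \<ge> 0" using xX[of 0] by simp
    have "M \<ge> 0" using HM[of 1] elim by simp
    have diff: "\<bar>x j - H j\<bar> \<le> K * L + \<eta> * X" if "j \<in> {1..n}" for j
    proof -
      obtain i where i: "j = i + 1" "i < n" using \<open>j \<in> {1..n}\<close> by (cases j) auto
      have "\<bar>x j - H j\<bar> \<le> K * (L + \<epsilon> * X)"
        unfolding i(1) x K_def
      proof (simp del: sum.atLeast0_atMost_Suc, rule abs_convolution_le[OF k])
        fix m assume "m \<le> i"
        then have "\<epsilon> * \<bar>x m\<bar> \<le> \<epsilon> * X" using xX[of m] i \<epsilon> by simp
        then show "\<bar>f (x m)\<bar> \<le> L + \<epsilon> * X" using L(2)[of "x m"] by linarith
      qed
      moreover have "K * \<epsilon> * X \<le> \<eta> * X" using \<epsilon> X0 by (intro mult_right_mono)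
      ultimately show ?thesis by (simp add: algebra_simps)
    qed
    have eX: "0 \<le> \<eta> * X" "\<eta> * X \<le> X / 2"
      using \<eta> X0 mult_right_mono[OF \<eta>(2) X0] by simp_all
    have "\<bar>x j\<bar> \<le> c + M + \<eta> * X" if "j \<le> n" for j
    proof (cases "j = 0")
      case True
      then show ?thesis using eX \<open>M \<ge> 0\<close> K L by (simp add: c_def)
    next
      case False
      then show ?thesis using diff[of j] HM[of j] that c by auto
    qed
    then have "X \<le> c + M + \<eta> * X"
      by (simp add: X_def max_abs_eq_max_pos max_pos_le_iff)
    then have "X \<le> 2 * (c + M)" using eX by (simp add: field_simps)
    then have "\<eta> * X \<le> \<eta> * (2 * (c + M))" using \<eta> by (intro mult_left_mono) auto
    then have "K * L + \<eta> * X \<le> c * (1 + 2 * \<eta>) + 2 * \<eta> * M"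
      using c by (simp add: algebra_simps)
    moreover have "2 * \<eta> * M \<le> \<delta> / 2 * M"
      using \<eta> \<open>M \<ge> 0\<close> by (intro mult_right_mono) auto
    moreover have "c * (1 + 2 * \<eta>) \<le> \<delta> / 2 * M"
      using elim d by (simp add: M_def divide_le_eq mult.commute)
    ultimately have "K * L + \<eta> * X \<le> \<delta> * M" by simp
    then show ?case using order.trans[OF diff] unfolding M_def by blast
  qed
qed

section \<open>Comparing the two one-sided extrema\<close>

text \<open>
  If \<open>max_pos 1 H n\<close> were negative for large \<open>n\<close>, it would stay between \<open>H 1\<close> and \<open>0\<close>
  while \<open>max_neg 1 H n\<close> diverges, so the ratio would be below \<open>-1\<close> and could not tend to \<open>l \<ge> 0\<close>.
\<close>

lemma eventually_max_pos_nonneg: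
  assumes H: "filterlim (max_abs 1 H) at_top sequentially"
    and l: "0 \<le> l" "neg_pos_ratio H \<longlonglongrightarrow> l"
  shows "\<forall>\<^sub>F n in sequentially. max_pos 1 H n \<ge> 0"
proof -
  have "\<forall>\<^sub>F n in sequentially. neg_pos_ratio H n > -1"
    using l by (intro order_tendstoD(1)[OF l(2)]) (auto intro: less_le_trans[of _ 0])
  moreover have "\<forall>\<^sub>F n in sequentially. max_abs 1 H n > \<bar>H 1\<bar>"
    using H by (simp add: filterlim_at_top_dense)
  ultimately show ?thesis
    using eventually_ge_at_top[of 1]
  proof eventually_elim
    case (elim n)
    show ?case
    proof (rule ccontr)
      assume neg: "\<not> ?thesis"
      have "H 1 \<le> max_pos 1 H n" using elim by (intro le_max_pos) auto
      then have "max_neg 1 H n > - max_pos 1 H n"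
        using neg elim by (auto simp: max_abs_eq_max)
      then have "max_neg 1 H n / max_pos 1 H n < -1"
        using neg by (simp add: divide_less_eq)
      then have "neg_pos_ratio H n < ereal (-1)"
        using neg unfolding neg_pos_ratio_def by (simp del: uminus_ereal.simps)
      then show False using elim by (simp add: one_ereal_def)
    qed
  qed
qed

text \<open>
  Cross-multiplying the ratio. When \<open>max_pos 1 H n = 0\<close> the ratio is \<open>\<infinity>\<close>, because then
  \<open>max_neg 1 H n = max_abs 1 H n > 0\<close>.
\<close>

lemma eventually_max_neg_less:
  assumes H: "filterlim (max_abs 1 H) at_top sequentially"
    and l: "0 \<le> l" "neg_pos_ratio H \<longlonglongrightarrow> l"
    and c: "l < ereal c"
  shows "\<forall>\<^sub>F n in sequentially. max_neg 1 H n < c * max_pos 1 H n"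
proof -
  have "\<forall>\<^sub>F n in sequentially. max_abs 1 H n > 0"
    using H by (simp add: filterlim_at_top_dense)
  then show ?thesis
    using eventually_max_pos_nonneg[OF H l] order_tendstoD(2)[OF l(2) c]
      eventually_ge_at_top[of 1]
  proof eventually_elim
    case (elim n)
    show ?case
    proof (cases "max_pos 1 H n = 0")
      case True
      then have "neg_pos_ratio H n = \<infinity>"
        using elim by (auto simp: neg_pos_ratio_def max_abs_eq_max divide_ereal_def max_def
            split: if_splits)
      then show ?thesis using elim by simp
    next
      case False
      then show ?thesis using elim by (auto simp: neg_pos_ratio_def divide_less_eq)
    qed
  qed
qed

lemma eventually_max_neg_greater:
  assumes H: "filterlim (max_abs 1 H) at_top sequentially"
    and l: "0 \<le> l" "neg_pos_ratio H \<longlonglongrightarrow> l"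
    and c: "ereal c < l"
  shows "\<forall>\<^sub>F n in sequentially. max_neg 1 H n > c * max_pos 1 H n"
proof -
  have "\<forall>\<^sub>F n in sequentially. max_abs 1 H n > 0"
    using H by (simp add: filterlim_at_top_dense)
  then show ?thesis
    using eventually_max_pos_nonneg[OF H l] order_tendstoD(1)[OF l(2) c]
      eventually_ge_at_top[of 1]
  proof eventually_elim
    case (elim n)
    show ?case
    proof (cases "max_pos 1 H n = 0")
      case True
      then show ?thesis using elim by (auto simp: max_abs_eq_max)
    next
      case False
      then show ?thesis using elim by (auto simp: neg_pos_ratio_def less_divide_eq)
    qed
  qed
qed

section \<open>Growth of the running extrema\<close>

theorem theorem6:
  fixes f :: "real \<Rightarrow> real" and k H x :: "nat \<Rightarrow> real" and \<xi> :: real and l :: ereal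
  assumes "continuous_on UNIV f"
    and "((\<lambda>y. f y / y) \<longlongrightarrow> 0) at_infinity"
    and "summable (\<lambda>j. \<bar>k j\<bar>)"
    and "x 0 = \<xi>"
    and "\<And>n. x (n + 1) = H (n + 1) + (\<Sum>j=0..n. k (n - j) * f (x j))"
    and "filterlim (max_abs 1 H) at_top sequentially"
    and "l \<in> {0..\<infinity>}"
    and "neg_pos_ratio H \<longlonglongrightarrow> l"
  shows
    "(l \<in> {0..<1} \<longrightarrow>
        filterlim (max_pos 0 x) at_top sequentially \<and>
        (\<lambda>n. max_pos 0 x n / max_pos 1 H n) \<longlonglongrightarrow> 1 \<and>
        (\<lambda>n. max_abs 0 x n / max_pos 1 H n) \<longlonglongrightarrow> 1) \<and>
     (l \<in> {1<..\<infinity>} \<longrightarrow>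
        filterlim (max_neg 0 x) at_top sequentially \<and>
        (\<lambda>n. max_neg 0 x n / max_neg 1 H n) \<longlonglongrightarrow> 1 \<and>
        (\<lambda>n. max_abs 0 x n / max_neg 1 H n) \<longlonglongrightarrow> 1) \<and>
     (l = 1 \<longrightarrow>
        filterlim (max_pos 0 x) at_top sequentially \<and>
        filterlim (max_neg 0 x) at_top sequentially \<and>
        (\<lambda>n. max_pos 0 x n / max_pos 1 H n) \<longlonglongrightarrow> 1 \<and>
        (\<lambda>n. max_neg 0 x n / max_neg 1 H n) \<longlonglongrightarrow> 1)"
proof -
  note H = assms(6)
  have l: "0 \<le> l" "neg_pos_ratio H \<longlonglongrightarrow> l" using assms by auto
  note close = volterra_close_to_forcing[OF assms(1-3,5) H]
  have pos: "filterlim (max_pos 0 x) at_top sequentially \<and>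
      (\<lambda>n. max_pos 0 x n / max_pos 1 H n) \<longlonglongrightarrow> 1"
    if "C > 0" "\<forall>\<^sub>F n in sequentially. max_abs 1 H n \<le> C * max_pos 1 H n" for C
    using max_pos_close_sequences[OF close H that] by blast
  have neg: "filterlim (max_neg 0 x) at_top sequentially \<and>
      (\<lambda>n. max_neg 0 x n / max_neg 1 H n) \<longlonglongrightarrow> 1"
    if C: "C > 0" "\<forall>\<^sub>F n in sequentially. max_abs 1 H n \<le> C * max_neg 1 H n" for C
  proof -
    have close': "\<forall>\<^sub>F n in sequentially. \<forall>j\<in>{1..n}. \<bar>- x j - - H j\<bar> \<le> \<delta> * max_abs 1 H n"
      if "\<delta> > 0" for \<delta>
      using close[OF that] by (simp add: abs_minus_commute)
    have eq: "\<forall>\<^sub>F n in sequentially. max_neg 1 H n = max_pos 1 (\<lambda>j. - H j) n"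
      using eventually_ge_at_top[of 1] by eventually_elim (rule max_neg_eq_max_pos)
    have "\<forall>\<^sub>F n in sequentially. max_abs 1 H n \<le> C * max_pos 1 (\<lambda>j. - H j) n"
      using C(2) eq by eventually_elim simp
    from max_pos_close_sequences[OF close' H C(1) this]
    have "filterlim (max_pos 0 (\<lambda>j. - x j)) at_top sequentially"
      and lim: "(\<lambda>n. max_pos 0 (\<lambda>j. - x j) n / max_pos 1 (\<lambda>j. - H j) n) \<longlonglongrightarrow> 1" by blast+
    moreover have x: "max_neg 0 x = max_pos 0 (\<lambda>j. - x j)"
      by (simp add: fun_eq_iff max_neg_eq_max_pos)
    moreover have "(\<lambda>n. max_neg 0 x n / max_neg 1 H n) \<longlonglongrightarrow> 1"
      by (rule Lim_transform_eventually[OF lim]) (use eq in eventually_elim, simp add: x)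
    ultimately show ?thesis by simp
  qed
  have abs: "(\<lambda>n. max_abs 0 x n / max_abs 1 H n) \<longlonglongrightarrow> 1"
    unfolding max_abs_eq_max_pos[of 0] max_abs_eq_max_pos[of 1]
  proof (rule max_pos_close_sequences(1)[where C = 1])
    show "\<forall>\<^sub>F n in sequentially. \<forall>j\<in>{1..n}. \<bar>\<bar>x j\<bar> - \<bar>H j\<bar>\<bar> \<le> \<delta> * max_abs 1 H n"
      if "\<delta> > 0" for \<delta>
      using close[OF that] by eventually_elim (auto intro: order.trans[OF abs_triangle_ineq3])
  qed (use H in \<open>simp_all add: max_abs_eq_max_pos\<close>)
  show ?thesis
  proof (intro conjI[of "l \<in> _ \<longrightarrow> _"] impI)
    assume "l \<in> {0..<1}"
    then have "\<forall>\<^sub>F n in sequentially. max_neg 1 H n < 1 * max_pos 1 H n"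
      by (intro eventually_max_neg_less[OF H l]) (simp flip: one_ereal_def)
    then have eq: "\<forall>\<^sub>F n in sequentially. max_abs 1 H n = max_pos 1 H n"
      using eventually_ge_at_top[of 1] by eventually_elim (simp add: max_abs_eq_max)
    have "(\<lambda>n. max_abs 0 x n / max_pos 1 H n) \<longlonglongrightarrow> 1"
      by (rule Lim_transform_eventually[OF abs]) (use eq in eventually_elim, simp)
    moreover have "\<forall>\<^sub>F n in sequentially. max_abs 1 H n \<le> 1 * max_pos 1 H n"
      using eq by eventually_elim simp
    ultimately show "filterlim (max_pos 0 x) at_top sequentially \<and>
        (\<lambda>n. max_pos 0 x n / max_pos 1 H n) \<longlonglongrightarrow> 1 \<and>
        (\<lambda>n. max_abs 0 x n / max_pos 1 H n) \<longlonglongrightarrow> 1"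
      using pos[of 1] by simp
  next
    assume "l \<in> {1<..\<infinity>}"
    then have "\<forall>\<^sub>F n in sequentially. max_neg 1 H n > 1 * max_pos 1 H n"
      by (intro eventually_max_neg_greater[OF H l]) (simp flip: one_ereal_def)
    then have eq: "\<forall>\<^sub>F n in sequentially. max_abs 1 H n = max_neg 1 H n"
      using eventually_ge_at_top[of 1] by eventually_elim (simp add: max_abs_eq_max)
    have "(\<lambda>n. max_abs 0 x n / max_neg 1 H n) \<longlonglongrightarrow> 1"
      by (rule Lim_transform_eventually[OF abs]) (use eq in eventually_elim, simp)
    moreover have "\<forall>\<^sub>F n in sequentially. max_abs 1 H n \<le> 1 * max_neg 1 H n"
      using eq by eventually_elim simp
    ultimately show "filterlim (max_neg 0 x) at_top sequentially \<and>
        (\<lambda>n. max_neg 0 x n / max_neg 1 H n) \<longlonglongrightarrow> 1 \<and>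
        (\<lambda>n. max_abs 0 x n / max_neg 1 H n) \<longlonglongrightarrow> 1"
      using neg[of 1] by simp
  next
    assume l1: "l = 1"
    \<comment> \<open>The constants \<open>2\<close> and \<open>1 / 2\<close> stand for any bounds on either side of \<open>1\<close>; they make each
        one-sided maximum at most twice the other.\<close>
    have "\<forall>\<^sub>F n in sequentially. max_neg 1 H n < 2 * max_pos 1 H n"
      by (intro eventually_max_neg_less[OF H l]) (simp add: l1 one_ereal_def)
    moreover have "\<forall>\<^sub>F n in sequentially. max_neg 1 H n > 1 / 2 * max_pos 1 H n"
      by (intro eventually_max_neg_greater[OF H l]) (simp add: l1 one_ereal_def)
    ultimately have "\<forall>\<^sub>F n in sequentially.
        max_abs 1 H n \<le> 2 * max_pos 1 H n \<and> max_abs 1 H n \<le> 2 * max_neg 1 H n"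
      using eventually_max_pos_nonneg[OF H l] eventually_ge_at_top[of 1]
      by eventually_elim (simp add: max_abs_eq_max)
    then show "filterlim (max_pos 0 x) at_top sequentially \<and>
        filterlim (max_neg 0 x) at_top sequentially \<and>
        (\<lambda>n. max_pos 0 x n / max_pos 1 H n) \<longlonglongrightarrow> 1 \<and>
        (\<lambda>n. max_neg 0 x n / max_neg 1 H n) \<longlonglongrightarrow> 1"
      using pos[of 2] neg[of 2] by (simp add: eventually_conj_iff)
  qed
qed

end
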